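(* Let $n$ be a positive integer. The walk matrix $W(A_n)$ of the Dynkin graph $A_n$ has the Smith normal form $$\operatorname{diag}(\underbrace{1,\ldots,1}_{\lceil\frac{n}{2}\rceil},0,\ldots,0),$$ an $n\times n$ diagonal matrix whose first $\lceil n/2\rceil$ diagonal entries are $1$ and whose remaining diagonal entries are $0$.
   Context: The Dynkin graph $A_n$ is the path graph on vertices $1,2,\ldots,n$, with $i$ and $j$ adjacent if and only if $|i-j|=1$. For a simple graph $G$ with $n$ vertices and adjacency matrix $A$, its walk matrix is the $n\times n$ integral matrix $W(G)=[e_n\ \ Ae_n\ \ \cdots\ \ A^{n-1}e_n]$, where $e_n$ is the all-ones column vector of dimension $n$. Smith normal form: for an $n\times n$ integral matrix $M$ of rank $r$, let $D(k)$ be the greatest common divisor of all $k\times k$ minors of $M$ and $D(0):=1$. The invariant factors of $M$ are $d_k=D(k)/D(k-1)$ for $k=1,\ldots,r$, and the Smith normal form of $M$ is the $n\times n$ matrix $\operatorname{diag}(d_1,\ldots,d_r,0,\ldots,0)$. *)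

theory Defs
  imports
    Complex_Main
    "Graph_Theory.Pair_Digraph"
    "Jordan_Normal_Form.DL_Rank_Submatrix"
begin

text \<open>Simple graphs are the finite symmetric loop-free pair digraphs of \<open>pair_graph\<close>.
  Matrix indices start at 0; index \<open>i\<close> stands for the \<open>i\<close>-th smallest vertex.\<close>

definition adjacency_matrix :: "'a::linorder pair_pre_digraph \<Rightarrow> int mat" where
  "adjacency_matrix G =
     (let n = card (pverts G); vs = sorted_list_of_set (pverts G)
      in mat n n (\<lambda>(i, j). if (vs ! i, vs ! j) \<in> parcs G then 1 else 0))"

definition walk_matrix :: "'a::linorder pair_pre_digraph \<Rightarrow> int mat" where
  "walk_matrix G =
     (let n = card (pverts G); A = adjacency_matrix G; e = vec n (\<lambda>_. 1)
      in mat_of_cols n (map (\<lambda>k. (A ^\<^sub>m k) *\<^sub>v e) [0..<n]))"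

definition dynkin_A :: "nat \<Rightarrow> nat pair_pre_digraph" where
  "dynkin_A n =
     \<lparr> pverts = {1..n},
       parcs = {(i, j). i \<in> {1..n} \<and> j \<in> {1..n} \<and> \<bar>int i - int j\<bar> = 1} \<rparr>"

lemma pair_graph_dynkin_A: "pair_graph (dynkin_A n)"
proof unfold_locales
  show "finite (parcs (dynkin_A n))"
    by (rule finite_subset[of _ "{1..n} \<times> {1..n}"]) (auto simp: dynkin_A_def)
next
  have "sym (parcs (dynkin_A n))"
    by (auto simp: dynkin_A_def intro!: symI)
  moreover have "arcs_ends (with_proj (dynkin_A n)) = parcs (dynkin_A n)"
    by (simp add: arcs_ends_def arc_to_ends_def with_proj_def)
  ultimately show "symmetric (dynkin_A n)"
    by (simp add: symmetric_def)
qed (auto simp: dynkin_A_def)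

lemma adjacency_matrix_dynkin_A:
  "adjacency_matrix (dynkin_A n) =
     mat n n (\<lambda>(i, j). if \<bar>int i - int j\<bar> = 1 then 1 else 0)"
proof -
  have vs: "sorted_list_of_set {Suc 0..n} = [1..<Suc n]"
    by (metis One_nat_def atLeastLessThanSuc_atLeastAtMost sorted_list_of_set_range)
  show ?thesis
    by (rule eq_matI)
      (auto simp: adjacency_matrix_def dynkin_A_def Let_def vs simp del: upt_Suc)
qed

text \<open>The empty minor has determinant 1, so \<open>det_divisor M 0 = 1\<close>.\<close>

definition det_divisor :: "int mat \<Rightarrow> nat \<Rightarrow> int" where
  "det_divisor M k =
     Gcd {det (submatrix M I J) | I J.
       I \<subseteq> {..<dim_row M} \<and> J \<subseteq> {..<dim_col M} \<and> card I = k \<and> card J = k}"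

lemma det_divisor_0: "det_divisor M 0 = 1"
proof -
  have fin: "I = {}" if "I \<subseteq> {..<m}" "card I = 0" for I and m :: nat
    using that finite_subset[of I "{..<m}"] by simp
  have minor: "det (submatrix M {} {}) = 1"
    by (rule det_dim_zero) (simp add: submatrix_def)
  have "{det (submatrix M I J) | I J. I \<subseteq> {..<dim_row M} \<and> J \<subseteq> {..<dim_col M}
          \<and> card I = 0 \<and> card J = 0} = {1}" (is "?S = _")
  proof
    show "?S \<subseteq> {1}"
      using minor by (blast dest: fin)
    have "det (submatrix M {} {}) \<in> ?S"
      by (intro CollectI exI[of _ "{}"]) simp
    then show "{1} \<subseteq> ?S"
      unfolding minor by blast
  qed
  then show ?thesis
    by (simp add: det_divisor_def)
qed

definition int_mat_rank :: "int mat \<Rightarrow> nat" where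
  "int_mat_rank M = vec_space.rank (dim_row M) (map_mat rat_of_int M)"

definition invariant_factor :: "int mat \<Rightarrow> nat \<Rightarrow> int" where
  "invariant_factor M k = det_divisor M k div det_divisor M (k - 1)"

definition smith_normal_form :: "int mat \<Rightarrow> int mat" where
  "smith_normal_form M =
     mat (dim_row M) (dim_col M)
       (\<lambda>(i, j). if i = j \<and> i < int_mat_rank M then invariant_factor M (i + 1) else 0)"

end

theory Submission
  imports Defs
begin

text \<open>Entry \<open>(i, k)\<close> of the walk matrix counts the walks of length \<open>k\<close> that start at the
  \<open>i\<close>-th vertex. A walk that is too short to leave the path at either end can turn freely at
  each step, so there are \<open>2 ^ k\<close> of them, and exactly one fewer when \<open>k\<close> is just large enough
  to leave the path at one end. Hence, among the first \<open>\<lceil>n / 2\<rceil>\<close> rows, the difference of rows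
  \<open>i\<close> and \<open>i - 1\<close> vanishes left of the diagonal and is 1 on it: all leading minors up to this
  order are 1. The reflection of the path makes rows \<open>i\<close> and \<open>n - 1 - i\<close> equal, so the rank is
  no larger.\<close>

lemma pick_lessThan: "i < k \<Longrightarrow> pick {..<k} i = i"
proof -
  assume "i < k"
  then have "{a \<in> {..<k}. a < i} = {..<i}" by auto
  with \<open>i < k\<close> show ?thesis
    using pick_card_in_set[of i "{..<k}"] by simp
qed

lemma submatrix_leading:
  assumes "k \<le> dim_row M" "k \<le> dim_col M"
  shows "submatrix M {..<k} {..<k} = mat k k (\<lambda>p. M $$ p)"
proof -
  have "{i. i < m \<and> i \<in> {..<k}} = {..<k}" if "k \<le> m" for m :: nat
    using that by auto
  then show ?thesis
    using assms by (auto simp: submatrix_def pick_lessThan intro!: eq_matI)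
qed

text \<open>Partial summation of row differences is left multiplication by the lower triangular
  all-ones matrix, so the matrix factors as \<open>L * U\<close>, where \<open>U\<close> collects
  the differences and is unitriangular.\<close>

lemma det_eq_1_if_row_differences_unitriangular:
  fixes f :: "nat \<Rightarrow> nat \<Rightarrow> 'a :: comm_ring_1"
  assumes first: "0 < k \<Longrightarrow> f 0 0 = 1"
    and diag: "\<And>i. Suc i < k \<Longrightarrow> f (Suc i) (Suc i) = f i (Suc i) + 1"
    and below: "\<And>i j. Suc i < k \<Longrightarrow> j \<le> i \<Longrightarrow> f (Suc i) j = f i j"
  shows "det (mat k k (\<lambda>(i, j). f i j)) = 1"
proof -
  \<comment> \<open>Keeping row 0 itself as the first difference lets the sums telescope without a
    boundary term.\<close>
  define d where "d i j = (case i of 0 \<Rightarrow> f 0 j | Suc l \<Rightarrow> f (Suc l) j - f l j)" for i j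
  define L where "L = mat k k (\<lambda>(i, j). if j \<le> i then 1 else 0 :: 'a)"
  define U where "U = mat k k (\<lambda>(i, j). d i j)"
  have L: "L \<in> carrier_mat k k" and U: "U \<in> carrier_mat k k"
    by (simp_all add: L_def U_def)
  have telescope: "(\<Sum>l\<le>i. d l j) = f i j" for i j
    by (induction i) (simp_all add: d_def)
  have "mat k k (\<lambda>(i, j). f i j) = L * U"
  proof (rule eq_matI)
    fix i j assume "i < dim_row (L * U)" and "j < dim_col (L * U)"
    then have ij: "i < k" "j < k" by (simp_all add: L_def U_def)
    have "(L * U) $$ (i, j) = (\<Sum>l<k. (if l \<le> i then 1 else 0) * d l j)"
      using ij by (simp add: L_def U_def scalar_prod_def lessThan_atLeast0)
    also have "\<dots> = (\<Sum>l\<le>i. d l j)"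
      using ij by (intro sum.mono_neutral_cong_right) auto
    finally show "mat k k (\<lambda>(i, j). f i j) $$ (i, j) = (L * U) $$ (i, j)"
      using ij by (simp add: telescope)
  qed (simp_all add: L_def U_def)
  moreover have "det L = 1"
    by (subst det_lower_triangular[OF _ L]) (auto simp: L_def prod_list_diag_prod)
  moreover have "det U = 1"
  proof -
    have "d i j = 0" if "j < i" "i < k" for i j
      using that below by (auto simp: d_def split: nat.split)
    then have "upper_triangular U"
      by (simp add: upper_triangular_def U_def)
    moreover have "d i i = 1" if "i < k" for i
      using that first diag by (auto simp: d_def split: nat.split)
    ultimately show ?thesis
      by (subst det_upper_triangular[OF _ U]) (auto simp: U_def prod_list_diag_prod)
  qed
  ultimately show ?thesis
    by (simp add: det_mult[OF L U])
qed

text \<open>Each summand is an outer product, of rank at most 1, and rank is subadditive.\<close>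

lemma (in vec_space) rank_le_sum_products:
  fixes f g :: "nat \<Rightarrow> nat \<Rightarrow> 'a"
  assumes "A \<in> carrier_mat n nc"
    and "\<And>r c. r < n \<Longrightarrow> c < nc \<Longrightarrow> A $$ (r, c) = (\<Sum>i<m. f i r * g i c)"
  shows "rank A \<le> m"
  using assms
proof (induction m arbitrary: A)
  case 0
  then have "A = 0\<^sub>m n nc" by (intro eq_matI) auto
  then show ?case by (simp add: rank_0I)
next
  case (Suc m)
  define B where "B = mat n nc (\<lambda>(r, c). \<Sum>i<m. f i r * g i c)"
  define C where "C = mat n nc (\<lambda>(r, c). f m r * g m c)"
  have BC: "B \<in> carrier_mat n nc" "C \<in> carrier_mat n nc"
    by (simp_all add: B_def C_def)
  have "A = B + C"
    using Suc.prems by (intro eq_matI) (auto simp: B_def C_def)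
  moreover have "rank B \<le> m"
    using BC by (intro Suc.IH) (simp_all add: B_def)
  moreover have "rank C \<le> 1"
    by (rule rank_le_1_product_entries[OF BC(2), where f = "f m" and g = "g m"])
      (simp add: C_def)
  ultimately show ?case
    using rank_subadditive[OF BC] by simp
qed

lemma rank_le_if_rows_symmetric:
  fixes A :: "'a :: field mat"
  assumes A: "A \<in> carrier_mat n nc"
    and sym: "\<And>r c. r < n \<Longrightarrow> c < nc \<Longrightarrow> A $$ (n - Suc r, c) = A $$ (r, c)"
  shows "vec_space.rank n A \<le> (n + 1) div 2"
proof (rule vec_space.rank_le_sum_products[OF A])
  fix r c assume rc: "r < n" "c < nc"
  \<comment> \<open>The representative of \<open>r\<close> under reflection in the first half, the
    middle row included. Row \<open>r\<close> is a copy of row \<open>?s\<close>, so the outer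
    products pair the indicator of a mirror pair with its common row.\<close>
  let ?s = "min r (n - Suc r)"
  have "(\<Sum>i<(n + 1) div 2. of_bool (i = ?s) * A $$ (i, c))
      = (\<Sum>i<(n + 1) div 2. if i = ?s then A $$ (i, c) else 0)"
    by (intro sum.cong) auto
  also have "\<dots> = A $$ (?s, c)"
    using rc by (subst sum.delta) auto
  also have "\<dots> = A $$ (r, c)"
    using sym[OF rc] by (simp add: min_def)
  finally show "A $$ (r, c) = (\<Sum>i<(n + 1) div 2. of_bool (i = ?s) * A $$ (i, c))" ..
qed

lemma det_divisor_eq_1:
  assumes "k \<le> dim_row M" "k \<le> dim_col M" "det (submatrix M {..<k} {..<k}) = 1"
  shows "det_divisor M k = 1"
proof -
  have "det_divisor M k dvd det (submatrix M {..<k} {..<k})"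
    unfolding det_divisor_def using assms by (intro Gcd_dvd CollectI exI conjI) auto
  \<comment> \<open>Dividing 1 leaves the sign open; normalization of \<open>Gcd\<close> excludes
    -1.\<close>
  moreover have "normalize (det_divisor M k) = det_divisor M k"
    by (simp add: det_divisor_def)
  ultimately show ?thesis
    using assms(3) by (metis is_unit_normalize)
qed

text \<open>The minor of order \<open>m\<close> stays nonzero over the rationals and forces rank at
  least \<open>m\<close>; up to order \<open>m\<close> the invariant factors are quotients of
  determinant divisors equal to 1.\<close>

lemma smith_normal_form_eq_if_leading_minors_eq_1:
  assumes M: "M \<in> carrier_mat n nc" and m: "m \<le> n" "m \<le> nc"
    and minors: "\<And>k. k \<le> m \<Longrightarrow> det (submatrix M {..<k} {..<k}) = 1"
    and rank: "int_mat_rank M \<le> m"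
  shows "smith_normal_form M = mat n nc (\<lambda>(i, j). if i = j \<and> i < m then 1 else 0)"
proof -
  let ?R = "map_mat rat_of_int M"
  have "submatrix ?R {..<m} {..<m} = map_mat rat_of_int (submatrix M {..<m} {..<m})"
    using M m by (auto simp: submatrix_leading intro!: eq_matI)
  then have "det (submatrix ?R {..<m} {..<m}) \<noteq> 0"
    using minors[of m] by (simp add: of_int_hom.hom_det)
  then have "card {j. j < nc \<and> j \<in> {..<m}} \<le> vec_space.rank n ?R"
    using M by (intro vec_space.rank_gt_minor) auto
  moreover have "{j. j < nc \<and> j \<in> {..<m}} = {..<m}"
    using m by auto
  ultimately have r: "int_mat_rank M = m"
    using rank M by (simp add: int_mat_rank_def)
  have "det_divisor M k = 1" if "k \<le> m" for k
    using that M m minors by (intro det_divisor_eq_1) auto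
  then have "invariant_factor M (i + 1) = 1" if "i < m" for i
    using that by (simp add: invariant_factor_def)
  then show ?thesis
    using M by (auto simp: smith_normal_form_def r intro!: eq_matI)
qed

text \<open>Recursion on the first step matches left multiplication by the adjacency matrix; the
  guards discard steps off the path.\<close>

fun walks :: "nat \<Rightarrow> nat \<Rightarrow> nat \<Rightarrow> int" where
  "walks n 0 i = 1"
| "walks n (Suc k) i =
     (if 0 < i then walks n k (i - 1) else 0) + (if i + 1 < n then walks n k (i + 1) else 0)"

text \<open>The power unfolds with its new factor on the right, while \<open>walks\<close> needs it
  on the left.\<close>

lemma pow_mat_Suc_mult_vec:
  assumes "A \<in> carrier_mat n n" "v \<in> carrier_vec n"
  shows "(A ^\<^sub>m Suc k) *\<^sub>v v = A *\<^sub>v ((A ^\<^sub>m k) *\<^sub>v v)"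
  using assms(2)
proof (induction k arbitrary: v)
  case 0
  then show ?case using assms(1) by auto
next
  case (Suc k)
  have p: "A ^\<^sub>m j \<in> carrier_mat n n" for j using assms(1) by simp
  have Av: "A *\<^sub>v v \<in> carrier_vec n" using assms(1) Suc.prems by simp
  have step: "(A ^\<^sub>m Suc j) *\<^sub>v v = (A ^\<^sub>m j) *\<^sub>v (A *\<^sub>v v)" for j
    using assoc_mult_mat_vec[OF p assms(1) Suc.prems] by simp
  show ?case
    by (simp only: step Suc.IH[OF Av])
qed

lemma adjacency_matrix_dynkin_A_mult_vec:
  assumes "i < n"
  shows "(adjacency_matrix (dynkin_A n) *\<^sub>v vec n v) $ i =
    (if 0 < i then v (i - 1) else 0) + (if i + 1 < n then v (i + 1) else 0)"
proof -
  have "(adjacency_matrix (dynkin_A n) *\<^sub>v vec n v) $ i =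
      (\<Sum>j<n. (if \<bar>int i - int j\<bar> = 1 then 1 else 0) * v j)"
    using assms by (simp add: adjacency_matrix_dynkin_A scalar_prod_def lessThan_atLeast0)
  \<comment> \<open>At \<open>i = 0\<close> truncated subtraction gives \<open>i - 1 = 0\<close>;
    the inner guard removes this false neighbour.\<close>
  also have "\<dots> = (\<Sum>j<n. (if j = i - 1 then if 0 < i then v j else 0 else 0)
      + (if j = i + 1 then v j else 0))"
    by (intro sum.cong) auto
  also have "\<dots> = (if 0 < i then v (i - 1) else 0) + (if i + 1 < n then v (i + 1) else 0)"
    using assms by (simp add: sum.distrib)
  finally show ?thesis .
qed

lemma pow_adjacency_matrix_dynkin_A_mult_ones:
  "(adjacency_matrix (dynkin_A n) ^\<^sub>m k) *\<^sub>v vec n (\<lambda>_. 1) = vec n (walks n k)"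
proof (induction k)
  case 0
  show ?case by (auto simp: adjacency_matrix_dynkin_A)
next
  case (Suc k)
  have A: "adjacency_matrix (dynkin_A n) \<in> carrier_mat n n"
    by (simp add: adjacency_matrix_dynkin_A)
  have "(adjacency_matrix (dynkin_A n) ^\<^sub>m Suc k) *\<^sub>v vec n (\<lambda>_. 1)
      = adjacency_matrix (dynkin_A n) *\<^sub>v vec n (walks n k)"
    using pow_mat_Suc_mult_vec[OF A] Suc.IH by simp
  also have "\<dots> = vec n (walks n (Suc k))"
    using A by (intro eq_vecI) (auto simp: adjacency_matrix_dynkin_A_mult_vec simp del: index_mult_mat_vec)
  finally show ?case .
qed

lemma walk_matrix_dynkin_A: "walk_matrix (dynkin_A n) = mat n n (\<lambda>(i, k). walks n k i)"
proof -
  have "card (pverts (dynkin_A n)) = n" by (simp add: dynkin_A_def)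
  then show ?thesis
    by (auto simp: walk_matrix_def Let_def pow_adjacency_matrix_dynkin_A_mult_ones
        mat_of_cols_index intro!: eq_matI)
qed

text \<open>Reflection swaps the two summands of the recursion together with their guards.\<close>

lemma walks_reflect: "i < n \<Longrightarrow> walks n k (n - Suc i) = walks n k i"
proof (induction k arbitrary: i)
  case (Suc k)
  have "walks n k (n - Suc i - 1) = walks n k (i + 1)" if "i + 1 < n"
    using Suc.IH[OF that] by simp
  moreover have "walks n k (n - Suc i + 1) = walks n k (i - 1)" if "0 < i"
    using Suc.IH[of "i - 1"] Suc.prems that by (simp add: Suc_diff_Suc)
  ultimately show ?case
    using Suc.prems by auto
qed simp

text \<open>Both bounds survive a step to either neighbour, since one step fewer remains.\<close>

lemma walks_eq_power: "k \<le> i \<Longrightarrow> i + k < n \<Longrightarrow> walks n k i = 2 ^ k"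
  by (induction k arbitrary: i) auto

lemma walks_Suc_self: "2 * i + 1 < n \<Longrightarrow> walks n (Suc i) i = 2 ^ Suc i - 1"
proof (induction i)
  case (Suc i)
  \<comment> \<open>A first step to the right puts both ends out of reach, so the single lost walk
    is the one that always goes left.\<close>
  have "walks n (Suc i) (Suc i + 1) = 2 ^ Suc i"
    using Suc.prems by (intro walks_eq_power) auto
  then show ?case
    using Suc by simp
qed simp

lemma det_leading_walk_matrix_dynkin_A:
  assumes "2 * k \<le> n + 1"
  shows "det (submatrix (walk_matrix (dynkin_A n)) {..<k} {..<k}) = 1"
proof -
  have kn: "k \<le> n" using assms by linarith
  then have "submatrix (walk_matrix (dynkin_A n)) {..<k} {..<k}
      = mat k k (\<lambda>(i, j). walks n j i)"
    by (subst submatrix_leading) (auto simp: walk_matrix_dynkin_A intro!: eq_matI)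
  moreover have "det (mat k k (\<lambda>(i, j). walks n j i)) = 1"
  proof (rule det_eq_1_if_row_differences_unitriangular)
    fix i assume "Suc i < k"
    \<comment> \<open>Just enough room on the right: row \<open>i + 1\<close> still has all
      \<open>2 ^ (i + 1)\<close> walks, row \<open>i\<close> one fewer.\<close>
    then have "2 * i + 2 < n" using assms by linarith
    then show "walks n (Suc i) (Suc i) = walks n (Suc i) i + 1"
      by (simp only: walks_Suc_self) (simp add: walks_eq_power del: walks.simps)
  next
    fix i j assume "Suc i < k" "j \<le> i"
    then show "walks n j (Suc i) = walks n j i"
      using assms by (simp add: walks_eq_power)
  qed simp
  ultimately show ?thesis by simp
qed

lemma rank_walk_matrix_dynkin_A: "int_mat_rank (walk_matrix (dynkin_A n)) \<le> (n + 1) div 2"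
  using rank_le_if_rows_symmetric[of "map_mat rat_of_int (walk_matrix (dynkin_A n))" n n]
  by (simp add: int_mat_rank_def walk_matrix_dynkin_A walks_reflect)

theorem theorem3p1:
  fixes n :: nat
  assumes "n \<ge> 1"
  shows "smith_normal_form (walk_matrix (dynkin_A n)) =
    mat n n (\<lambda>(i, j). if i = j \<and> i < nat \<lceil>real n / 2\<rceil> then 1 else 0)"
proof -
  have "nat \<lceil>real n / 2\<rceil> = (n + 1) div 2"
    by linarith
  moreover have "smith_normal_form (walk_matrix (dynkin_A n)) =
      mat n n (\<lambda>(i, j). if i = j \<and> i < (n + 1) div 2 then 1 else 0)"
    by (intro smith_normal_form_eq_if_leading_minors_eq_1 rank_walk_matrix_dynkin_A
        det_leading_walk_matrix_dynkin_A) (auto simp: walk_matrix_dynkin_A)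
  ultimately show ?thesis by simp
qed

end
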